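(* Let $G$ be a connected graph of order $n\ge2$ with $\mathrm{mr}_+^{\mathbb{R}}(G)=\mathrm{mr}_+^{\mathbb{C}}(G)=:\mathrm{mr}_+(G)$ and $OS(G)=\mathrm{mr}_+(G)$, and let $H$ be a connected graph with more than one vertex with $\mathrm{mr}_+^{\mathbb{R}}(H)=\mathrm{mr}_+^{\mathbb{C}}(H)=:\mathrm{mr}_+(H)$ and $OS(H)=\mathrm{mr}_+(H)$. Then $\mathrm{mr}_+^{\mathbb{R}}(G\circ H)=\mathrm{mr}_+^{\mathbb{C}}(G\circ H)$, and this common value $\mathrm{mr}_+(G\circ H)$ satisfies $$\mathrm{mr}_+(G\circ H)=n\,\mathrm{mr}_+(H)+\mathrm{mr}_+(G).$$
   Context: All graphs are finite and simple. For an $N\times N$ Hermitian matrix $A$, $\mathcal{G}(A)$ is the simple graph on $\{1,\dots,N\}$ in which distinct $i,j$ are adjacent iff $A_{ij}\ne0$ (the diagonal is unconstrained). For a graph $G$ on $N$ vertices, $\mathrm{mr}_+^{\mathbb{R}}(G)$ (resp. $\mathrm{mr}_+^{\mathbb{C}}(G)$) is the minimum rank of a real symmetric (resp. complex Hermitian) positive semidefinite $N\times N$ matrix $B$ with $\mathcal{G}(B)=G$. If the two numbers are equal, the common value is denoted $\mathrm{mr}_+(G)$. OS-number: let $G=(V,E)$ be a connected graph with more than one vertex and $S=\{v_1,\dots,v_r\}$ an ordered set of (distinct) vertices of $G$. For $1\le k\le r$ let $G_k$ be the subgraph induced by $v_1,\dots,v_k$, and let $H_k=(V_k,E_k)$ be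 the connected component of $G_k$ containing $v_k$. If for each $k$ there is $w_k\in V$ with $w_k\ne v_l$ for all $l\le k$, $\{v_k,w_k\}\in E$, and $\{w_k,v_l\}\notin E$ for all $v_l\in V_k$ with $l\ne k$, then $S$ is called an OS-vertex set. $OS(G)$ is the maximum cardinality of an OS-vertex set of $G$. The corona product $G_1\circ G_2$ of $G_1=(V_1,E_1)$ with $G_2=(V_2,E_2)$ is the graph of order $|V_1||V_2|+|V_1|$ obtained by taking one copy of $G_1$ and $|V_1|$ copies of $G_2$, and joining every vertex of the $i$th copy of $G_2$ to the $i$th vertex of $G_1$. *)

theory Defs
  imports "HOL-Analysis.Analysis"
begin

text \<open>
  A finite simple graph is an irreflexive symmetric adjacency relation on a finite type: the vertex
  set is the whole type \<open>'v\<close>, so the order of the graph is \<open>CARD('v)\<close>. The rows and columns of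
  matrices are indexed by the same type.
\<close>

type_synonym 'v graph = "'v \<Rightarrow> 'v \<Rightarrow> bool"

definition simple_graph :: "'v graph \<Rightarrow> bool" where
  "simple_graph G \<longleftrightarrow> symp G \<and> irreflp G"

definition connected_graph :: "'v graph \<Rightarrow> bool" where
  "connected_graph G \<longleftrightarrow> (\<forall>u v. G\<^sup>*\<^sup>* u v)"


definition graph_of_matrix :: "'k::zero ^ 'n ^ 'n \<Rightarrow> 'n graph" where
  "graph_of_matrix A = (\<lambda>i j. i \<noteq> j \<and> A $ i $ j \<noteq> 0)"

definition real_psd :: "real ^ 'n ^ 'n \<Rightarrow> bool" where
  "real_psd B \<longleftrightarrow> (\<forall>i j. B $ i $ j = B $ j $ i) \<and> (\<forall>x. 0 \<le> x \<bullet> (B *v x))"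

text \<open>For a Hermitian matrix \<open>B\<close> the number \<open>x\<^sup>* B x\<close> is real, so taking \<open>Re\<close> loses nothing.\<close>

definition complex_psd :: "complex ^ 'n ^ 'n \<Rightarrow> bool" where
  "complex_psd B \<longleftrightarrow> (\<forall>i j. B $ i $ j = cnj (B $ j $ i)) \<and>
     (\<forall>x. 0 \<le> Re (\<Sum>i\<in>UNIV. cnj (x $ i) * (B *v x) $ i))"

definition mr_plus_real :: "'n::finite graph \<Rightarrow> nat" where
  "mr_plus_real G =
     (LEAST r. \<exists>B :: real ^ 'n ^ 'n. real_psd B \<and> graph_of_matrix B = G \<and> rank B = r)"

definition mr_plus_complex :: "'n::finite graph \<Rightarrow> nat" where
  "mr_plus_complex G =
     (LEAST r. \<exists>B :: complex ^ 'n ^ 'n. complex_psd B \<and> graph_of_matrix B = G \<and> rank B = r)"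


definition induced :: "'v graph \<Rightarrow> 'v set \<Rightarrow> 'v graph" where
  "induced G S = (\<lambda>u v. u \<in> S \<and> v \<in> S \<and> G u v)"

text \<open>The vertex set of the connected component containing \<open>v \<in> S\<close> of the subgraph induced by \<open>S\<close>.\<close>

definition component :: "'v graph \<Rightarrow> 'v set \<Rightarrow> 'v \<Rightarrow> 'v set" where
  "component G S v = {u. (induced G S)\<^sup>*\<^sup>* v u}"

text \<open>
  Positions are counted from 0, so \<open>set (take (Suc k) vs)\<close> consists of \<open>vs ! k\<close> and all earlier
  vertices. The empty list is admitted.
\<close>

definition OS_vertex_set :: "'v graph \<Rightarrow> 'v list \<Rightarrow> bool" where
  "OS_vertex_set G vs \<longleftrightarrow> distinct vs \<and>
     (\<forall>k < length vs. \<exists>w. w \<notin> set (take (Suc k) vs) \<and> G (vs ! k) w \<and>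
        (\<forall>u \<in> component G (set (take (Suc k) vs)) (vs ! k). u \<noteq> vs ! k \<longrightarrow> \<not> G w u))"

definition OS :: "'v::finite graph \<Rightarrow> nat" where
  "OS G = Max {card (set vs) | vs. OS_vertex_set G vs}"


text \<open>\<open>Inl i\<close> is the vertex \<open>i\<close> of \<open>G\<close>, and \<open>Inr (i, x)\<close> is the vertex \<open>x\<close> of the \<open>i\<close>-th copy of \<open>H\<close>.\<close>

fun corona :: "'a graph \<Rightarrow> 'b graph \<Rightarrow> ('a + 'a \<times> 'b) graph" where
  "corona G H (Inl i) (Inl j) = G i j"
| "corona G H (Inl i) (Inr (j, x)) = (i = j)"
| "corona G H (Inr (i, x)) (Inl j) = (i = j)"
| "corona G H (Inr (i, x)) (Inr (j, y)) = (i = j \<and> H x y)"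


lemma simple_graph_corona:
  assumes "simple_graph G" "simple_graph H"
  shows "simple_graph (corona G H)"
proof -
  have "corona G H u v \<Longrightarrow> corona G H v u" for u v
    using assms by (cases "(G, H, u, v)" rule: corona.cases)
      (auto simp: simple_graph_def dest: sympD)
  moreover have "\<not> corona G H u u" for u
    using assms by (cases "(G, H, u, u)" rule: corona.cases)
      (auto simp: simple_graph_def irreflp_def)
  ultimately show ?thesis
    by (auto simp: simple_graph_def symp_def irreflp_def)
qed

text \<open>
  The minimum in the definition of \<open>mr_plus_real\<close> and \<open>mr_plus_complex\<close> is over a nonempty set
  (witnessed by the signless Laplacian), and the maximum in the definition of \<open>OS\<close> is over a
  finite nonempty set.
\<close>

definition signless :: "'n::finite graph \<Rightarrow> 'k::comm_ring_1 ^ 'n ^ 'n" where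
  "signless G = (\<chi> i j. if i = j then (\<Sum>k\<in>UNIV. of_bool (G i k)) else of_bool (G i j))"

lemma graph_of_matrix_signless:
  assumes "simple_graph G"
  shows "graph_of_matrix (signless G :: 'k::comm_ring_1 ^ 'n ^ 'n) = G"
  using assms by (auto simp: graph_of_matrix_def signless_def simple_graph_def irreflp_def fun_eq_iff)

lemma signless_mult:
  assumes "simple_graph G"
  shows "(signless G *v x) $ i = (\<Sum>j\<in>UNIV. of_bool (G i j) * (x $ i + x $ j))"
proof -
  have irr: "\<not> G i i" using assms by (auto simp: simple_graph_def irreflp_def)
  have "(signless G *v x) $ i =
      (\<Sum>j\<in>UNIV. (if i = j then (\<Sum>k\<in>UNIV. of_bool (G i k)) * x $ i else 0) + of_bool (G i j) * x $ j)"
    unfolding matrix_vector_mult_def using irr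
    by (auto simp: signless_def intro!: sum.cong)
  also have "\<dots> = (\<Sum>k\<in>UNIV. of_bool (G i k)) * x $ i + (\<Sum>j\<in>UNIV. of_bool (G i j) * x $ j)"
    by (simp add: sum.distrib)
  finally show ?thesis by (simp add: sum_distrib_right sum.distrib distrib_left)
qed

lemma complex_psd_signless:
  assumes "simple_graph G"
  shows "complex_psd (signless G)"
proof -
  have sym: "G i j \<longleftrightarrow> G j i" for i j using assms by (auto simp: simple_graph_def dest: sympD)
  have "0 \<le> Re (\<Sum>i\<in>UNIV. cnj (x $ i) * (signless G *v x) $ i)" for x :: "complex ^ 'a"
  proof -
    define f where "f i j = of_bool (G i j) * cnj (x $ i) * (x $ i + x $ j)" for i j
    define S where "S = (\<Sum>i\<in>UNIV. \<Sum>j\<in>UNIV. f i j)"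
    have S: "(\<Sum>i\<in>UNIV. cnj (x $ i) * (signless G *v x) $ i) = S"
      by (simp add: S_def f_def signless_mult[OF assms] sum_distrib_left mult_ac
          del: sum_of_bool_mult_eq sum_mult_of_bool_eq)
    have "S + S = (\<Sum>i\<in>UNIV. \<Sum>j\<in>UNIV. f i j) + (\<Sum>i\<in>UNIV. \<Sum>j\<in>UNIV. f j i)"
      unfolding S_def by (subst (2) sum.swap) simp
    also have "\<dots> = (\<Sum>i\<in>UNIV. \<Sum>j\<in>UNIV. f i j + f j i)"
      by (simp add: sum.distrib)
    finally have "Re S + Re S = (\<Sum>i\<in>UNIV. \<Sum>j\<in>UNIV. Re (f i j + f j i))"
      by (metis (no_types, lifting) Re_sum plus_complex.sel(1) sum.cong)
    moreover have "0 \<le> Re (f i j + f j i)" for i j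
    proof -
      have "f i j + f j i = of_bool (G i j) * (cnj (x $ i + x $ j) * (x $ i + x $ j))"
        by (simp add: f_def sym[of j i] algebra_simps)
      also have "\<dots> = complex_of_real (of_bool (G i j) * (cmod (x $ i + x $ j))\<^sup>2)"
        unfolding of_real_mult complex_norm_square by (simp add: mult.commute)
      finally have "Re (f i j + f j i) = of_bool (G i j) * (cmod (x $ i + x $ j))\<^sup>2"
        by (simp only: Re_complex_of_real)
      then show ?thesis by simp
    qed
    ultimately have "0 \<le> Re S + Re S" by (simp add: sum_nonneg)
    then show ?thesis unfolding S by simp
  qed
  moreover have "signless G $ i $ j = cnj (signless G $ j $ i)" for i j
    by (auto simp: signless_def sym[of i j])
  ultimately show ?thesis unfolding complex_psd_def by blast
qed

lemma real_psd_signless: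
  assumes "simple_graph G"
  shows "real_psd (signless G)"
proof -
  have sym: "G i j \<longleftrightarrow> G j i" for i j using assms by (auto simp: simple_graph_def dest: sympD)
  have "0 \<le> x \<bullet> (signless G *v x)" for x :: "real ^ 'a"
  proof -
    define f where "f i j = of_bool (G i j) * x $ i * (x $ i + x $ j)" for i j
    define S where "S = (\<Sum>i\<in>UNIV. \<Sum>j\<in>UNIV. f i j)"
    have S: "x \<bullet> (signless G *v x) = S"
      by (simp add: S_def f_def inner_vec_def signless_mult[OF assms] sum_distrib_left mult_ac
          del: sum_of_bool_mult_eq sum_mult_of_bool_eq)
    have "S + S = (\<Sum>i\<in>UNIV. \<Sum>j\<in>UNIV. f i j) + (\<Sum>i\<in>UNIV. \<Sum>j\<in>UNIV. f j i)"
      unfolding S_def by (subst (2) sum.swap) simp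
    also have "\<dots> = (\<Sum>i\<in>UNIV. \<Sum>j\<in>UNIV. f i j + f j i)"
      by (simp add: sum.distrib)
    finally have "S + S = (\<Sum>i\<in>UNIV. \<Sum>j\<in>UNIV. f i j + f j i)" .
    moreover have "0 \<le> f i j + f j i" for i j
    proof -
      have "f i j + f j i = of_bool (G i j) * (x $ i + x $ j)\<^sup>2"
        by (simp add: f_def sym[of j i] algebra_simps power2_eq_square)
      then show ?thesis by simp
    qed
    ultimately have "0 \<le> S + S" by (simp add: sum_nonneg)
    then show ?thesis unfolding S by simp
  qed
  moreover have "signless G $ i $ j = (signless G $ j $ i :: real)" for i j
    by (auto simp: signless_def sym[of i j])
  ultimately show ?thesis unfolding real_psd_def by blast
qed

lemma mr_plus_real_attained:
  fixes G :: "'n::finite graph"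
  assumes "simple_graph G"
  shows "\<exists>B :: real ^ 'n ^ 'n. real_psd B \<and> graph_of_matrix B = G \<and> rank B = mr_plus_real G"
  unfolding mr_plus_real_def
  by (rule LeastI_ex) (use real_psd_signless graph_of_matrix_signless assms in blast)

lemma mr_plus_complex_attained:
  fixes G :: "'n::finite graph"
  assumes "simple_graph G"
  shows "\<exists>B :: complex ^ 'n ^ 'n. complex_psd B \<and> graph_of_matrix B = G \<and> rank B = mr_plus_complex G"
  unfolding mr_plus_complex_def
  by (rule LeastI_ex) (use complex_psd_signless graph_of_matrix_signless assms in blast)

lemma OS_attained:
  fixes G :: "'v::finite graph"
  shows "\<exists>vs. OS_vertex_set G vs \<and> card (set vs) = OS G"
    and "OS_vertex_set G vs \<Longrightarrow> card (set vs) \<le> OS G"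
proof -
  let ?A = "{card (set vs) | vs. OS_vertex_set G vs}"
  have "?A \<subseteq> {..CARD('v)}" by (auto intro: card_mono)
  then have fin: "finite ?A" by (rule finite_subset) simp
  have "OS_vertex_set G []" by (simp add: OS_vertex_set_def)
  then have "?A \<noteq> {}" by blast
  with fin have "OS G \<in> ?A" unfolding OS_def by (rule Max_in)
  then show "\<exists>vs. OS_vertex_set G vs \<and> card (set vs) = OS G" by force
  show "OS_vertex_set G vs \<Longrightarrow> card (set vs) \<le> OS G"
    unfolding OS_def by (rule Max_ge[OF fin]) blast
qed

end

theory Submission
  imports Defs
begin

text \<open>
  The proof is the chain \<open>mr\<^sub>+\<^sup>\<complex>(G \<circ> H) \<ge> OS(G \<circ> H) \<ge> n OS(H) + OS(G) = n mr\<^sub>+(H) + mr\<^sub>+(G)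
  \<ge> mr\<^sub>+\<^sup>\<real>(G \<circ> H) \<ge> mr\<^sub>+\<^sup>\<complex>(G \<circ> H)\<close>. The first inequality holds for every graph, because a
  positive semidefinite matrix is injective on the vectors supported on an OS-vertex set. For the
  second, list OS-vertex sets of all copies of \<open>H\<close> first and one of \<open>G\<close> last. For the third, a real
  optimal matrix \<open>B\<close> of \<open>H\<close> extends to the join of \<open>H\<close> with one new vertex without increasing the
  rank: border it by \<open>B z\<close> for a vector \<open>z\<close> such that \<open>B z\<close> has no zero entry.
\<close>

section \<open>OS-vertex sets bound the rank from below\<close>

text \<open>The condition at a position mentions only the prefix ending there, so appending a vertex
  leaves all earlier conditions untouched. This makes \<open>rev_induct\<close> the natural
  induction for OS-vertex sets.\<close>

lemma OS_vertex_set_snoc: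
  "OS_vertex_set G (vs @ [v]) \<longleftrightarrow> OS_vertex_set G vs \<and> v \<notin> set vs \<and>
     (\<exists>w. w \<notin> insert v (set vs) \<and> G v w \<and>
       (\<forall>u \<in> component G (insert v (set vs)) v. u \<noteq> v \<longrightarrow> \<not> G w u))"
proof -
  have "(\<forall>k < Suc (length vs). P (take (Suc k) (vs @ [v])) ((vs @ [v]) ! k)) \<longleftrightarrow>
      (\<forall>k < length vs. P (take (Suc k) vs) (vs ! k)) \<and> P (vs @ [v]) v" for P
    by (auto simp: less_Suc_eq nth_append)
  from this[of "\<lambda>us t. \<exists>w. w \<notin> set us \<and> G t w \<and> (\<forall>u \<in> component G (set us) t. u \<noteq> t \<longrightarrow> \<not> G w u)"]
  show ?thesis by (auto simp: OS_vertex_set_def)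
qed

section \<open>Components of induced subgraphs\<close>

lemma component_refl: "v \<in> component G S v"
  by (simp add: component_def)

lemma component_subset: "v \<in> S \<Longrightarrow> component G S v \<subseteq> S"
  unfolding component_def by (auto elim!: rtranclp.cases simp: induced_def)

lemma component_step:
  "u \<in> component G S v \<Longrightarrow> u \<in> S \<Longrightarrow> t \<in> S \<Longrightarrow> G u t \<Longrightarrow> t \<in> component G S v"
  unfolding component_def by (auto intro: rtranclp.rtrancl_into_rtrancl simp: induced_def)

text \<open>Gives upper bounds on components in the corona. \<open>K\<close> only has to be closed
  under edges inside \<open>S\<close> and may stick out of \<open>S\<close>, so convenient oversized
  sets are allowed.\<close>

lemma component_subset_closed:
  assumes "v \<in> K" and "\<And>u t. u \<in> K \<Longrightarrow> u \<in> S \<Longrightarrow> t \<in> S \<Longrightarrow> G u t \<Longrightarrow> t \<in> K"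
  shows "component G S v \<subseteq> K"
proof
  fix u assume "u \<in> component G S v"
  then have "(induced G S)\<^sup>*\<^sup>* v u" by (simp add: component_def)
  then show "u \<in> K"
  proof induction
    case base
    show ?case by (rule assms(1))
  next
    case (step u t)
    then show ?case using assms(2)[of u t] by (simp add: induced_def)
  qed
qed

section \<open>The Hermitian form of a matrix and its kernel\<close>

definition sesq :: "complex ^ 'n ^ 'n \<Rightarrow> complex ^ 'n \<Rightarrow> complex ^ 'n \<Rightarrow> complex" where
  "sesq B x y = (\<Sum>i\<in>UNIV. cnj (x $ i) * (B *v y) $ i)"

lemma sesq_diff_left: "sesq B (x - y) z = sesq B x z - sesq B y z"
  by (simp add: sesq_def left_diff_distrib sum_subtractf)

lemma sesq_diff_right: "sesq B x (y - z) = sesq B x y - sesq B x z"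
  by (simp add: sesq_def matrix_vector_mult_diff_distrib right_diff_distrib sum_subtractf)

lemma sesq_scale_left: "sesq B (c *s x) y = cnj c * sesq B x y"
  by (simp add: sesq_def sum_distrib_left mult_ac)

lemma sesq_scale_right: "sesq B x (c *s y) = c * sesq B x y"
  by (simp add: sesq_def matrix_vector_mult_scaleR vector_scalar_commute sum_distrib_left mult_ac)

lemma sesq_commute:
  assumes "complex_psd B"
  shows "sesq B y x = cnj (sesq B x y)"
proof -
  have herm: "cnj (B $ i $ j) = B $ j $ i" for i j
    using assms by (metis complex_psd_def complex_cnj_cnj)
  have "sesq B y x = (\<Sum>i\<in>UNIV. \<Sum>j\<in>UNIV. cnj (y $ i) * (B $ i $ j * x $ j))"
    by (simp add: sesq_def matrix_vector_mult_def sum_distrib_left)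
  also have "\<dots> = (\<Sum>j\<in>UNIV. \<Sum>i\<in>UNIV. cnj (y $ i) * (B $ i $ j * x $ j))"
    by (rule sum.swap)
  also have "\<dots> = cnj (sesq B x y)"
    by (simp add: sesq_def matrix_vector_mult_def sum_distrib_left herm mult_ac)
  finally show ?thesis .
qed

text \<open>With \<open>e = B *v x\<close>, the form at \<open>x - t e\<close> equals
  \<open>t * (t * q - 2 * N)\<close>, where \<open>N\<close> is the squared norm of
  \<open>e\<close>. For small positive \<open>t\<close> this is negative unless
  \<open>e = 0\<close>.\<close>

lemma complex_psd_kernel:
  assumes psd: "complex_psd B" and zero: "sesq B x x = 0"
  shows "B *v x = 0"
proof (rule ccontr)
  assume nz: "B *v x \<noteq> 0"
  define e where "e = B *v x"
  define N where "N = (\<Sum>i\<in>UNIV. (cmod (e $ i))\<^sup>2)"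
  define q where "q = Re (sesq B e e)"
  have "sesq B e x = complex_of_real N"
    by (simp add: sesq_def N_def e_def complex_norm_square mult.commute del: of_real_power)
  then have ex: "sesq B e x = complex_of_real N" "sesq B x e = complex_of_real N"
    using sesq_commute[OF psd, of x e] by simp_all
  obtain i where "e $ i \<noteq> 0"
    using nz by (auto simp: e_def vec_eq_iff)
  then have "N > 0" unfolding N_def by (intro sum_pos2[of _ i]) auto
  \<comment> \<open>This choice gives \<open>t * q \<le> N < 2 * N\<close>; the summand 1 keeps the
    denominator positive when \<open>q = 0\<close>.\<close>
  define t where "t = N / (\<bar>q\<bar> + 1)"
  have "t > 0" using \<open>N > 0\<close> by (simp add: t_def)
  have "t * q \<le> t * (\<bar>q\<bar> + 1)" using \<open>t > 0\<close> by (intro mult_left_mono) auto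
  also have "\<dots> = N" unfolding t_def by (simp add: field_simps)
  finally have "t * q - 2 * N < 0" using \<open>N > 0\<close> by simp
  then have "t * (t * q - 2 * N) < 0" using \<open>t > 0\<close> by (simp add: mult_pos_neg)
  moreover have "0 \<le> Re (sesq B (x - complex_of_real t *s e) (x - complex_of_real t *s e))"
    using psd unfolding complex_psd_def sesq_def by blast
  moreover have "Re (sesq B (x - complex_of_real t *s e) (x - complex_of_real t *s e)) = t * (t * q - 2 * N)"
    by (simp add: sesq_diff_left sesq_diff_right sesq_scale_left sesq_scale_right zero ex q_def algebra_simps)
  ultimately show False by linarith
qed

text \<open>Peel off the last vertex \<open>v\<close>. The part \<open>y\<close> of \<open>x\<close>
  on the component of \<open>v\<close> has form value 0, hence lies in the kernel. Row
  \<open>w\<close> of \<open>B *v y\<close> then contains the single term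
  \<open>B $ w $ v * x $ v\<close>, which forces \<open>x $ v = 0\<close>. The vector
  \<open>x\<close> stays the same throughout the induction; only the set known to contain its
  support shrinks.\<close>

lemma psd_injective_on_OS_support:
  fixes B :: "complex ^ 'n ^ 'n"
  assumes psd: "complex_psd B" and "graph_of_matrix B = G"
    and "OS_vertex_set G vs" and "B *v x = 0" and "\<And>i. i \<notin> set vs \<Longrightarrow> x $ i = 0"
  shows "x = 0"
  using assms(3,5)
proof (induction vs rule: rev_induct)
  case Nil
  then show ?case by (simp add: vec_eq_iff)
next
  case (snoc v vs)
  let ?S = "insert v (set vs)"
  define C where "C = component G ?S v"
  have C: "v \<in> C" "C \<subseteq> ?S"
    unfolding C_def by (auto simp: component_refl dest: component_subset[THEN subsetD, rotated])
  have G: "G i j \<longleftrightarrow> i \<noteq> j \<and> B $ i $ j \<noteq> 0" for i j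
    using assms(2) by (auto simp: graph_of_matrix_def fun_eq_iff)
  obtain w where w: "w \<notin> ?S" "G v w" "\<And>u. u \<in> C \<Longrightarrow> u \<noteq> v \<Longrightarrow> \<not> G w u"
    using snoc.prems(1) unfolding OS_vertex_set_snoc C_def by blast
  define y where "y = (\<chi> i. if i \<in> C then x $ i else 0)"
  \<comment> \<open>\<open>B\<close> does not couple the component to the rest of the support: a
    nonzero entry from \<open>C\<close> to another vertex of \<open>?S\<close> would put that vertex
    into \<open>C\<close>.\<close>
  have "cnj (y $ i) * (B $ i $ j * (x - y) $ j) = 0" for i j
  proof (rule ccontr)
    assume "\<not> ?thesis"
    then have ij: "i \<in> C" "j \<notin> C" "x $ j \<noteq> 0" "B $ i $ j \<noteq> 0"
      by (auto simp: y_def split: if_splits)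
    then have "j \<in> ?S" using snoc.prems(2)[of j] by auto
    moreover have "G i j" using ij by (auto simp: G)
    ultimately show False
      using ij C component_step[of i G ?S v j] by (auto simp: C_def)
  qed
  then have "sesq B y (x - y) = 0"
    unfolding sesq_def matrix_vector_mult_def
    by (simp add: sum_distrib_left sum.neutral del: vector_minus_component mult_eq_0_iff)
  moreover have "sesq B y x = 0" using \<open>B *v x = 0\<close> by (simp add: sesq_def)
  ultimately have "sesq B y y = 0" by (simp add: sesq_diff_right)
  then have "B *v y = 0" by (rule complex_psd_kernel[OF psd])
  then have "(B *v y) $ w = 0" by simp
  then have "0 = (\<Sum>j\<in>UNIV. B $ w $ j * y $ j)"
    by (simp add: matrix_vector_mult_def)
  also have "\<dots> = (\<Sum>j\<in>UNIV. if j = v then B $ w $ v * x $ v else 0)"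
  proof (rule sum.cong)
    fix j
    have "B $ w $ j = 0" if "j \<in> C" "j \<noteq> v"
      using that w(1) w(3)[of j] C(2) by (auto simp: G)
    then show "B $ w $ j * y $ j = (if j = v then B $ w $ v * x $ v else 0)"
      using C(1) by (auto simp: y_def)
  qed simp
  also have "\<dots> = B $ w $ v * x $ v" by simp
  finally have "B $ w $ v * x $ v = 0" by simp
  \<comment> \<open>The edge gives a nonzero entry at \<open>(v, w)\<close>; Hermitian symmetry
    moves it to \<open>(w, v)\<close>.\<close>
  moreover have "B $ w $ v \<noteq> 0"
    using psd w(2) by (metis G complex_psd_def complex_cnj_zero_iff)
  ultimately have "x $ v = 0" by simp
  then have "x $ i = 0" if "i \<notin> set vs" for i
    using snoc.prems(2)[of i] that by (cases "i = v") auto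
  moreover have "OS_vertex_set G vs" using snoc.prems(1) by (simp add: OS_vertex_set_snoc)
  ultimately show ?case by (intro snoc.IH)
qed

text \<open>A linear relation among the rows indexed by the OS-vertex set yields a kernel vector
  supported on that set, so it is trivial by the preceding injectivity.\<close>

lemma card_OS_vertex_set_le_rank:
  fixes B :: "complex ^ 'n ^ 'n"
  assumes psd: "complex_psd B" and "graph_of_matrix B = G" and "OS_vertex_set G vs"
  shows "card (set vs) \<le> rank B"
proof -
  let ?S = "set vs"
  have herm: "cnj (B $ i $ j) = B $ j $ i" for i j
    using psd by (metis complex_psd_def complex_cnj_cnj)
  have indep: "c i = 0" if c: "(\<Sum>i\<in>?S. c i *s row i B) = 0" and i: "i \<in> ?S" for c i
  proof -
    \<comment> \<open>Conjugating the coefficients turns a relation among rows into one among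
      columns, because \<open>B\<close> is Hermitian.\<close>
    define x where "x = (\<chi> i. if i \<in> ?S then cnj (c i) else 0)"
    have "(B *v x) $ j = 0" for j
    proof -
      have "(B *v x) $ j = (\<Sum>i\<in>UNIV. if i \<in> ?S then B $ j $ i * cnj (c i) else 0)"
        by (auto simp: matrix_vector_mult_def x_def intro!: sum.cong)
      also have "\<dots> = (\<Sum>i\<in>?S. B $ j $ i * cnj (c i))"
        by (simp add: sum.If_cases)
      also have "\<dots> = cnj ((\<Sum>i\<in>?S. c i *s row i B) $ j)"
        unfolding cnj_sum sum_component by (simp add: row_def herm mult.commute)
      finally show ?thesis using c by simp
    qed
    then have "B *v x = 0" by (simp add: vec_eq_iff)
    then have "x = 0"
      by (rule psd_injective_on_OS_support[OF assms]) (simp add: x_def)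
    then have "x $ i = 0" by simp
    then show ?thesis using i by (simp add: x_def)
  qed
  \<comment> \<open>Independence of the set of rows does not detect repetitions, so equal rows are
    excluded separately, by the relation with coefficients 1 at \<open>i\<close> and -1 at
    \<open>j\<close>.\<close>
  have inj: "inj_on (\<lambda>i. row i B) ?S"
  proof (rule inj_onI, rule ccontr)
    fix i j assume ij: "i \<in> ?S" "j \<in> ?S" "row i B = row j B" "i \<noteq> j"
    define c where "c k = (if k = i then 1 else 0) - (if k = j then 1 else 0 :: complex)" for k
    have "(\<Sum>k\<in>?S. c k *s row k B) =
        (\<Sum>k\<in>?S. if k = i then row i B else 0) - (\<Sum>k\<in>?S. if k = j then row j B else 0)"
      unfolding sum_subtractf[symmetric] c_def by (intro sum.cong) (auto simp: vec_eq_iff)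
    then have "(\<Sum>k\<in>?S. c k *s row k B) = 0" using ij by simp
    from indep[OF this ij(1)] show False using ij(4) by (simp add: c_def)
  qed
  have "vec.independent ((\<lambda>i. row i B) ` ?S)"
  proof (subst vec.dependent_finite, simp, safe)
    fix u i assume "(\<Sum>r\<in>(\<lambda>i. row i B) ` ?S. u r *s r) = 0" and i: "i \<in> ?S" "u (row i B) \<noteq> 0"
    then have "(\<Sum>i\<in>?S. u (row i B) *s row i B) = 0" by (simp add: sum.reindex[OF inj])
    from indep[OF this i(1)] i(2) show False by simp
  qed
  moreover have "(\<lambda>i. row i B) ` ?S \<subseteq> rows B" by (auto simp: rows_def)
  ultimately have "card ((\<lambda>i. row i B) ` ?S) \<le> rank B"
    unfolding row_rank_def_gen by (intro vec.independent_card_le_dim)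
  then show ?thesis by (simp add: card_image[OF inj])
qed

lemma OS_le_mr_plus_complex:
  assumes "simple_graph G"
  shows "OS G \<le> mr_plus_complex G"
  using OS_attained(1)[of G] mr_plus_complex_attained[OF assms] card_OS_vertex_set_le_rank by metis

section \<open>The OS-number of a corona\<close>

text \<open>Distinct copies are linked only through base vertices. While no base vertex has been
  listed, the component of a new vertex stays in its own copy, and the witness found in
  \<open>H\<close> works inside that copy.\<close>

lemma OS_vertex_set_append_copy:
  assumes "OS_vertex_set (corona G H) us" and "\<And>x. Inr (i, x) \<notin> set us" and "\<And>j. Inl j \<notin> set us"
    and "OS_vertex_set H ts"
  shows "OS_vertex_set (corona G H) (us @ map (\<lambda>t. Inr (i, t)) ts)"
  using assms(4)
proof (induction ts rule: rev_induct)
  case Nil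
  then show ?case using assms(1) by simp
next
  case (snoc t ts)
  let ?f = "\<lambda>t. Inr (i, t)"
  let ?S = "insert (?f t) (set (us @ map ?f ts))" and ?C = "component H (insert t (set ts)) t"
  from snoc.prems obtain w where w: "w \<notin> insert t (set ts)" "H t w"
      "\<And>u. u \<in> ?C \<Longrightarrow> u \<noteq> t \<Longrightarrow> \<not> H w u" and t: "t \<notin> set ts" and ts: "OS_vertex_set H ts"
    unfolding OS_vertex_set_snoc by blast
  have sub: "component (corona G H) ?S (?f t) \<subseteq> ?f ` ?C"
  proof (rule component_subset_closed)
    fix u v assume "u \<in> ?f ` ?C" and v: "v \<in> ?S" and uv: "corona G H u v"
    then obtain y where y: "u = ?f y" "y \<in> ?C" by blast
    then obtain z where z: "v = ?f z" "H y z"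
      using v uv assms(3) by (cases v) auto
    then have "z \<in> insert t (set ts)" using v assms(2) by auto
    moreover have "y \<in> insert t (set ts)" using y(2) component_subset[of t "insert t (set ts)" H] by auto
    ultimately have "z \<in> ?C" using component_step[OF y(2)] z(2) by simp
    then show "v \<in> ?f ` ?C" using z(1) by simp
  qed (simp add: component_refl)
  have "\<not> corona G H (?f w) u" if "u \<in> component (corona G H) ?S (?f t)" "u \<noteq> ?f t" for u
  proof -
    obtain y where "u = ?f y" "y \<in> ?C" using sub \<open>u \<in> component (corona G H) ?S (?f t)\<close> by blast
    then show ?thesis using w(3) that(2) by simp
  qed
  moreover have "?f w \<notin> ?S" "corona G H (?f t) (?f w)"
    using w(1,2) assms(2) by auto
  ultimately have "\<exists>w. w \<notin> ?S \<and> corona G H (?f t) w \<and>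
      (\<forall>u \<in> component (corona G H) ?S (?f t). u \<noteq> ?f t \<longrightarrow> \<not> corona G H w u)"
    by blast
  moreover have "?f t \<notin> set (us @ map ?f ts)" using t assms(2) by auto
  ultimately have "OS_vertex_set (corona G H) ((us @ map ?f ts) @ [?f t])"
    unfolding OS_vertex_set_snoc using snoc.IH[OF ts] by blast
  then show ?case by simp
qed

lemma OS_vertex_set_all_copies:
  assumes "OS_vertex_set H ts" and "distinct is"
  shows "OS_vertex_set (corona G H) (concat (map (\<lambda>i. map (\<lambda>t. Inr (i, t)) ts) is))"
  using assms(2)
proof (induction "is" rule: rev_induct)
  case Nil
  then show ?case by (simp add: OS_vertex_set_def)
next
  case (snoc i "is")
  then show ?case
    using OS_vertex_set_append_copy[OF _ _ _ assms(1),
        of G "concat (map (\<lambda>i. map (\<lambda>t. Inr (i, t)) ts) is)" i] by auto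
qed

text \<open>The component of a base vertex may run into copies, but only into those attached to base
  vertices of its component in \<open>G\<close>. The witness \<open>w\<close> for \<open>G\<close>
  lies outside that component, so \<open>Inl w\<close> is adjacent to none of these copies.\<close>

lemma OS_vertex_set_append_base:
  assumes "OS_vertex_set (corona G H) us" and us: "\<And>j. Inl j \<notin> set us" and "OS_vertex_set G ss"
  shows "OS_vertex_set (corona G H) (us @ map Inl ss)"
  using assms(3)
proof (induction ss rule: rev_induct)
  case Nil
  then show ?case using assms(1) by simp
next
  case (snoc s ss)
  let ?S = "insert (Inl s) (set (us @ map Inl ss))" and ?C = "component G (insert s (set ss)) s"
  from snoc.prems obtain w where w: "w \<notin> insert s (set ss)" "G s w"
      "\<And>u. u \<in> ?C \<Longrightarrow> u \<noteq> s \<Longrightarrow> \<not> G w u" and s: "s \<notin> set ss" and ss: "OS_vertex_set G ss"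
    unfolding OS_vertex_set_snoc by blast
  have sub: "?C \<subseteq> insert s (set ss)" by (rule component_subset) simp
  \<comment> \<open>Whole copies are included, whether or not all their vertices are listed; closure
    then holds because an edge with an end in a copy preserves the base index.\<close>
  have "component (corona G H) ?S (Inl s) \<subseteq> Inl ` ?C \<union> Inr ` (?C \<times> UNIV)"
  proof (rule component_subset_closed)
    fix u v assume u: "u \<in> Inl ` ?C \<union> Inr ` (?C \<times> UNIV)" and v: "v \<in> ?S" and uv: "corona G H u v"
    show "v \<in> Inl ` ?C \<union> Inr ` (?C \<times> UNIV)"
    proof (cases "\<exists>i j. u = Inl i \<and> v = Inl j")
      case True
      then obtain i j where "u = Inl i" "v = Inl j" by blast
      then have "i \<in> ?C" "G i j" "j \<in> insert s (set ss)" using u v uv us by auto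
      then have "j \<in> ?C" using component_step[of i G "insert s (set ss)" s j] sub by blast
      then show ?thesis using \<open>v = Inl j\<close> by blast
    next
      case False
      then show ?thesis
        using u uv by (cases "(G, H, u, v)" rule: corona.cases) auto
    qed
  qed (simp add: component_refl)
  then have "\<not> corona G H (Inl w) u" if "u \<in> component (corona G H) ?S (Inl s)" "u \<noteq> Inl s" for u
    using that w(1,3) sub by (cases u) auto
  moreover have "Inl w \<notin> ?S" "corona G H (Inl s) (Inl w)"
    using w(1,2) us by auto
  ultimately have "\<exists>w. w \<notin> ?S \<and> corona G H (Inl s) w \<and>
      (\<forall>u \<in> component (corona G H) ?S (Inl s). u \<noteq> Inl s \<longrightarrow> \<not> corona G H w u)"
    by blast
  moreover have "Inl s \<notin> set (us @ map Inl ss)" using s us by auto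
  ultimately have "OS_vertex_set (corona G H) ((us @ map Inl ss) @ [Inl s])"
    unfolding OS_vertex_set_snoc using snoc.IH[OF ss] by blast
  then show ?case by simp
qed

lemma OS_corona_ge:
  fixes G :: "'a::finite graph" and H :: "'b::finite graph"
  shows "CARD('a) * OS H + OS G \<le> OS (corona G H)"
proof -
  obtain ss ts where ss: "OS_vertex_set G ss" "card (set ss) = OS G"
    and ts: "OS_vertex_set H ts" "card (set ts) = OS H"
    using OS_attained(1) by metis
  obtain "is" where "is": "set is = (UNIV :: 'a set)" "distinct is"
    using finite_distinct_list[of "UNIV :: 'a set"] by auto
  let ?us = "concat (map (\<lambda>i. map (\<lambda>t. Inr (i, t)) ts) is)"
  have "OS_vertex_set (corona G H) (?us @ map Inl ss)"
    by (rule OS_vertex_set_append_base[OF OS_vertex_set_all_copies]) (use "is" ss ts in auto)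
  moreover have "set (?us @ map Inl ss) = Inr ` (UNIV \<times> set ts) \<union> Inl ` set ss"
    using "is" by auto
  moreover have "card (Inr ` (UNIV \<times> set ts) \<union> Inl ` set ss :: ('a + 'a \<times> 'b) set) =
      CARD('a) * card (set ts) + card (set ss)"
    by (subst card_Un_disjoint) (auto simp: card_image card_cartesian_product)
  ultimately show ?thesis using OS_attained(2) ss ts by metis
qed

section \<open>A real matrix for the corona\<close>

lemma rank_add_le:
  fixes A B :: "real ^ 'n ^ 'm"
  shows "rank (A + B) \<le> rank A + rank B"
proof -
  let ?A = "range ((*v) A)" and ?B = "range ((*v) B)"
  have "subspace ?A" "subspace ?B" by (auto intro: linear_subspace_image)
  have "dim (range ((*v) (A + B))) \<le> dim {x + y |x y. x \<in> ?A \<and> y \<in> ?B}"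
    by (rule dim_subset) (auto simp: matrix_vector_mult_add_rdistrib)
  also have "\<dots> \<le> dim ?A + dim ?B"
    using dim_sums_Int[OF \<open>subspace ?A\<close> \<open>subspace ?B\<close>] by linarith
  finally show ?thesis by (simp add: rank_dim_range)
qed

lemma rank_sum_le:
  fixes A :: "'i \<Rightarrow> real ^ 'n ^ 'm"
  assumes "finite I"
  shows "rank (\<Sum>i\<in>I. A i) \<le> (\<Sum>i\<in>I. rank (A i))"
  using assms by induction (auto intro: order_trans[OF rank_add_le])

lemma rank_congruence_le:
  fixes A :: "real ^ 'm ^ 'm" and Q :: "real ^ 'n ^ 'm"
  shows "rank (transpose Q ** A ** Q) \<le> rank A"
  by (meson order_trans rank_mul_le_left rank_mul_le_right)

lemma congruence_nth:
  fixes A :: "real ^ 'm ^ 'm" and Q :: "real ^ 'n ^ 'm"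
  shows "(transpose Q ** A ** Q) $ u $ v = column u Q \<bullet> (A *v column v Q)"
  unfolding matrix_mul_assoc[symmetric]
  by (simp add: matrix_matrix_mult_def transpose_def matrix_vector_mult_def column_def inner_vec_def)

lemma real_psd_congruence:
  fixes A :: "real ^ 'm ^ 'm" and Q :: "real ^ 'n ^ 'm"
  assumes "real_psd A"
  shows "real_psd (transpose Q ** A ** Q)"
proof -
  have sym: "transpose A = A" using assms by (simp add: real_psd_def transpose_def vec_eq_iff)
  have "x \<bullet> ((transpose Q ** A ** Q) *v x) = (Q *v x) \<bullet> (A *v (Q *v x))" for x
    by (metis dot_lmul_matrix matrix_vector_mul_assoc transpose_transpose vector_transpose_matrix)
  moreover have "transpose (transpose Q ** A ** Q) = transpose Q ** A ** Q"
    by (simp add: matrix_transpose_mul sym matrix_mul_assoc)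
  ultimately show ?thesis
    using assms by (simp add: real_psd_def transpose_def vec_eq_iff)
qed

lemma real_psd_add: "real_psd A \<Longrightarrow> real_psd B \<Longrightarrow> real_psd (A + B)"
  by (simp add: real_psd_def matrix_vector_mult_add_rdistrib inner_add_right)

lemma real_psd_sum:
  fixes A :: "'i \<Rightarrow> real ^ 'n ^ 'n"
  assumes "finite I" "\<And>i. i \<in> I \<Longrightarrow> real_psd (A i)"
  shows "real_psd (\<Sum>i\<in>I. A i)"
proof -
  have "real_psd (0 :: real ^ 'n ^ 'n)" by (simp add: real_psd_def)
  with assms show ?thesis by (induction I rule: finite_induct) (auto intro: real_psd_add)
qed

text \<open>Each nonzero row rules out only a hyperplane of vectors \<open>z\<close>, and finitely
  many hyperplanes form a negligible set, which cannot be the whole space.\<close>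

lemma ex_mult_nowhere_zero:
  fixes A :: "real ^ 'n ^ 'm"
  assumes "\<And>i. row i A \<noteq> 0"
  shows "\<exists>z. \<forall>i. (A *v z) $ i \<noteq> 0"
proof -
  have "negligible (\<Union>i. {z. row i A \<bullet> z = 0})"
    by (rule negligible_Union) (auto intro!: negligible_hyperplane simp: assms)
  then have "(\<Union>i. {z. row i A \<bullet> z = 0}) \<noteq> UNIV" by auto
  then show ?thesis
    by (auto simp: row_def matrix_mult_dot)
qed

text \<open>Take the first edge of a path to another vertex. A neighbour at every vertex guarantees
  that a matrix with graph \<open>H\<close> has no zero row.\<close>

lemma connected_graph_ex_neighbour:
  fixes H :: "'b::finite graph"
  assumes "connected_graph H" "CARD('b) > 1"
  shows "\<exists>y. H x y"
proof -
  have "UNIV \<noteq> {x}"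
    using assms(2) by (metis card.empty card.insert empty_iff finite.emptyI less_irrefl One_nat_def)
  then obtain y where "y \<noteq> x" by blast
  moreover have "H\<^sup>*\<^sup>* x y" using assms(1) by (simp add: connected_graph_def)
  ultimately show ?thesis by (metis converse_rtranclpE)
qed

text \<open>\<open>M\<close> adds \<open>A\<close> on the base and, for each base vertex, a bordered
  \<open>B\<close> on that vertex and its copy. Every summand is a congruence, so ranks do not grow
  and semidefiniteness is kept. The summands overlap only in diagonal entries at base vertices,
  where the graph imposes nothing.\<close>

lemma mr_plus_real_corona_le:
  fixes G :: "'a::finite graph" and H :: "'b::finite graph"
  assumes G: "simple_graph G" and H: "simple_graph H" and nbr: "\<And>x. \<exists>y. H x y"
  shows "mr_plus_real (corona G H) \<le> CARD('a) * mr_plus_real H + mr_plus_real G"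
proof -
  obtain A :: "real ^ 'a ^ 'a" where A: "real_psd A" "graph_of_matrix A = G" "rank A = mr_plus_real G"
    using mr_plus_real_attained[OF G] by blast
  obtain B :: "real ^ 'b ^ 'b" where B: "real_psd B" "graph_of_matrix B = H" "rank B = mr_plus_real H"
    using mr_plus_real_attained[OF H] by blast
  have "row x B \<noteq> 0" for x
    using nbr[of x] unfolding B(2)[symmetric] by (auto simp: graph_of_matrix_def row_def vec_eq_iff)
  then obtain z where z: "\<And>x. (B *v z) $ x \<noteq> 0" using ex_mult_nowhere_zero by blast
  define P :: "real ^ ('a + 'a \<times> 'b) ^ 'a" where
    "P = (\<chi> i u. case u of Inl j \<Rightarrow> of_bool (i = j) | Inr _ \<Rightarrow> 0)"
  \<comment> \<open>Column \<open>z\<close> at base vertex \<open>k\<close> and unit columns on copy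
    \<open>k\<close>: the congruence yields \<open>B\<close> bordered by \<open>B *v z\<close>, with
    corner \<open>z \<bullet> (B *v z)\<close>.\<close>
  define Q :: "'a \<Rightarrow> real ^ ('a + 'a \<times> 'b) ^ 'b" where
    "Q k = (\<chi> x u. case u of Inl j \<Rightarrow> of_bool (j = k) * z $ x | Inr (j, y) \<Rightarrow> of_bool (j = k \<and> x = y))" for k
  define M where "M = transpose P ** A ** P + (\<Sum>k\<in>UNIV. transpose (Q k) ** B ** Q k)"
  have P: "column (Inl i) P = axis i 1" "column (Inr p) P = 0" for i p
    by (auto simp: P_def column_def axis_def vec_eq_iff)
  have Q: "column (Inl i) (Q k) = (if i = k then z else 0)"
      "column (Inr (i, x)) (Q k) = (if i = k then axis x 1 else 0)" for i x k
    by (auto simp: Q_def column_def axis_def vec_eq_iff)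
  have M: "M $ u $ v = column u P \<bullet> (A *v column v P) + (\<Sum>k\<in>UNIV. column u (Q k) \<bullet> (B *v column v (Q k)))"
    for u v
    by (simp add: M_def congruence_nth)
  have "real_psd M"
    unfolding M_def by (intro real_psd_add real_psd_sum real_psd_congruence A B) simp
  have symM: "M $ u $ v = M $ v $ u" for u v
    using \<open>real_psd M\<close> by (simp add: real_psd_def)
  have M_ll: "M $ Inl i $ Inl j \<noteq> 0 \<longleftrightarrow> G i j" if "i \<noteq> j" for i j
  proof -
    \<comment> \<open>For \<open>i \<noteq> j\<close>, no single \<open>Q k\<close> has nonzero
      columns at both base vertices.\<close>
    have "(\<Sum>k\<in>UNIV. column (Inl i) (Q k) \<bullet> (B *v column (Inl j) (Q k))) = 0"
      using that by (intro sum.neutral) (auto simp: Q)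
    then show ?thesis
      using that unfolding M A(2)[symmetric]
      by (simp add: P inner_axis' matrix_vector_mul_component graph_of_matrix_def inner_axis)
  qed
  have M_rr: "M $ Inr (i, x) $ Inr (j, y) = (if i = j then B $ x $ y else 0)" for i x j y
  proof -
    have "(\<Sum>k\<in>UNIV. column (Inr (i, x)) (Q k) \<bullet> (B *v column (Inr (j, y)) (Q k))) =
        (\<Sum>k\<in>UNIV. if k = i then (if i = j then B $ x $ y else 0) else 0)"
      by (intro sum.cong) (auto simp: Q inner_axis' matrix_vector_mul_component inner_axis)
    then show ?thesis unfolding M by (simp add: P)
  qed
  have M_rl: "M $ Inr (i, x) $ Inl j = (if i = j then (B *v z) $ x else 0)" for i x j
  proof -
    have "(\<Sum>k\<in>UNIV. column (Inr (i, x)) (Q k) \<bullet> (B *v column (Inl j) (Q k))) =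
        (\<Sum>k\<in>UNIV. if k = i then (if i = j then (B *v z) $ x else 0) else 0)"
      by (intro sum.cong) (auto simp: Q inner_axis')
    then show ?thesis unfolding M by (simp add: P)
  qed
  have "(u \<noteq> v \<and> M $ u $ v \<noteq> 0) = corona G H u v" for u v
    using G H z B(2)
    by (cases "(G, H, u, v)" rule: corona.cases)
      (auto simp: M_ll M_rr M_rl symM[of "Inl _" "Inr _"] simple_graph_def irreflp_def graph_of_matrix_def
        dest: M_ll[THEN iffD2, rotated])
  then have "graph_of_matrix M = corona G H"
    by (simp add: graph_of_matrix_def fun_eq_iff)
  with \<open>real_psd M\<close> have "mr_plus_real (corona G H) \<le> rank M"
    unfolding mr_plus_real_def by (intro Least_le) blast
  also have "\<dots> \<le> rank (transpose P ** A ** P) + rank (\<Sum>k\<in>UNIV. transpose (Q k) ** B ** Q k)"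
    unfolding M_def by (rule rank_add_le)
  also have "\<dots> \<le> rank A + (\<Sum>k\<in>UNIV. rank (transpose (Q k) ** B ** Q k))"
    by (rule add_mono[OF rank_congruence_le rank_sum_le]) simp
  also have "\<dots> \<le> rank A + (\<Sum>k\<in>(UNIV :: 'a set). rank B)"
    by (rule add_left_mono[OF sum_mono[OF rank_congruence_le]])
  finally show ?thesis by (simp add: A B)
qed

section \<open>From real to complex matrices\<close>

definition complexify :: "real ^ 'n ^ 'm \<Rightarrow> complex ^ 'n ^ 'm" where
  "complexify B = (\<chi> i j. complex_of_real (B $ i $ j))"

text \<open>A real basis of the row space, read as complex vectors, still spans the rows over the
  complex numbers, so its size bounds the complex rank.\<close>

lemma rank_complexify_le:
  fixes B :: "real ^ 'n ^ 'm"
  shows "rank (complexify B) \<le> rank B"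
proof -
  define f :: "real ^ 'n \<Rightarrow> complex ^ 'n" where "f x = (\<chi> i. complex_of_real (x $ i))" for x
  obtain S where S: "S \<subseteq> rows B" "rows B \<subseteq> span S" "card S = dim (rows B)" "independent S"
    using basis_exists[of "rows B"] by metis
  have fin: "finite S" using S(4) by (rule independent_imp_finite)
  have "f x \<in> vec.span (f ` S)" if "x \<in> span S" for x
    using that
  proof (induction rule: span_induct_alt)
    case base
    have "f 0 = 0" by (simp add: f_def vec_eq_iff)
    then show ?case by (simp add: vec.span_zero)
  next
    case (step c x y)
    have "f (c *\<^sub>R x + y) = complex_of_real c *s f x + f y" by (simp add: f_def vec_eq_iff)
    then show ?case using step by (auto intro!: vec.span_add vec.span_scale intro: vec.span_base)
  qed
  moreover have "rows (complexify B) = f ` rows B"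
    by (auto simp: rows_def row_def complexify_def f_def)
  ultimately have "rows (complexify B) \<subseteq> vec.span (f ` S)" using S(2) by auto
  then have "vec.dim (rows (complexify B)) \<le> card (f ` S)"
    by (rule vec.dim_le_card) (simp add: fin)
  also have "\<dots> \<le> card S" by (rule card_image_le[OF fin])
  finally show ?thesis by (simp add: row_rank_def_gen[of "complexify B"] row_rank_def S(3))
qed

lemma complex_psd_complexify:
  fixes B :: "real ^ 'n ^ 'n"
  assumes "real_psd B"
  shows "complex_psd (complexify B)"
proof -
  have "0 \<le> Re (\<Sum>i\<in>UNIV. cnj (x $ i) * (complexify B *v x) $ i)" for x
  proof -
    define a b :: "real ^ 'n" where "a = (\<chi> i. Re (x $ i))" and "b = (\<chi> i. Im (x $ i))"
    \<comment> \<open>The products mixing real and imaginary parts of \<open>x\<close> are purely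
      imaginary, so only the two real forms survive.\<close>
    have "Re (\<Sum>i\<in>UNIV. cnj (x $ i) * (complexify B *v x) $ i) = a \<bullet> (B *v a) + b \<bullet> (B *v b)"
      by (simp add: complexify_def matrix_vector_mult_def inner_vec_def a_def b_def sum.distrib)
    also have "\<dots> \<ge> 0" using assms by (simp add: real_psd_def)
    finally show ?thesis .
  qed
  then show ?thesis
    using assms by (simp add: complex_psd_def real_psd_def complexify_def)
qed

lemma mr_plus_complex_le_real:
  assumes "simple_graph G"
  shows "mr_plus_complex G \<le> mr_plus_real G"
proof -
  obtain B where B: "real_psd B" "graph_of_matrix B = G" "rank B = mr_plus_real G"
    using mr_plus_real_attained[OF assms] by blast
  have "graph_of_matrix (complexify B) = G"
    using B(2) by (simp add: graph_of_matrix_def complexify_def)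
  then have "mr_plus_complex G \<le> rank (complexify B)"
    unfolding mr_plus_complex_def using complex_psd_complexify[OF B(1)] by (intro Least_le) blast
  also have "\<dots> \<le> mr_plus_real G" using rank_complexify_le[of B] B(3) by simp
  finally show ?thesis .
qed

theorem theorem3p12:
  fixes G :: "'a::finite graph" and H :: "'b::finite graph" and n :: nat
  assumes "simple_graph G" and "connected_graph G" and "CARD('a) = n" and "n \<ge> 2"
    and "mr_plus_real G = mr_plus_complex G" and "OS G = mr_plus_real G"
    and "simple_graph H" and "connected_graph H" and "CARD('b) > 1"
    and "mr_plus_real H = mr_plus_complex H" and "OS H = mr_plus_real H"
  shows "mr_plus_real (corona G H) = mr_plus_complex (corona G H) \<and>
         mr_plus_real (corona G H) = n * mr_plus_real H + mr_plus_real G"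
proof -
  have simple: "simple_graph (corona G H)" using assms by (intro simple_graph_corona)
  have "n * mr_plus_real H + mr_plus_real G \<le> OS (corona G H)"
    using OS_corona_ge[of H G] assms by simp
  also have "\<dots> \<le> mr_plus_complex (corona G H)" by (rule OS_le_mr_plus_complex[OF simple])
  finally have "n * mr_plus_real H + mr_plus_real G \<le> mr_plus_complex (corona G H)" .
  moreover have "mr_plus_complex (corona G H) \<le> mr_plus_real (corona G H)"
    by (rule mr_plus_complex_le_real[OF simple])
  moreover have "mr_plus_real (corona G H) \<le> n * mr_plus_real H + mr_plus_real G"
    using mr_plus_real_corona_le[OF assms(1,7)] connected_graph_ex_neighbour[OF assms(8,9)] assms(3)
    by blast
  ultimately show ?thesis by linarith
qed

end
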